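(* Let $\widehat a$ be an admissible function (of type (a) or of type (b)), with associated parameter $v>0$ (and $u\in(0,1)$ for type (b)), and let $\alpha\in\mathbb{N}_0^d$. Then for any $k\ge 1$ there exists a constant $c_k$ depending only on $k$, $\alpha$, $d$, and $\widehat a$ such that $$ \Big|\frac{\partial^\alpha}{\partial x^\alpha}\Lambda_n(x,y)\Big| \le c_k\,\frac{n^{\frac{|\alpha|}{2}}\,[K_{n+[vn]+|\alpha|+k}(x,x)]^{\frac12}\,[K_{n+[vn]+k}(y,y)]^{\frac12}}{(1+n^{\frac12}|x-y|)^k}. $$ Here the dependence of $c_k$ on $\widehat a$ is of the form $c_k=c(k,|\alpha|,u,d)\max_{0\le l\le k}\|\widehat a^{(l)}\|_{\infty}$ (with $u:=1$ for type (a)).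
   Context: Hermite functions: $H_n(t)=(-1)^n e^{t^2}\big(\frac{d}{dt}\big)^n e^{-t^2}$, $h_n(t):=(2^n n!\sqrt\pi)^{-1/2}H_n(t)e^{-t^2/2}$ for $t\in\mathbb{R}$, $n\ge 0$; for $\alpha\in\mathbb{N}_0^d$ and $x\in\mathbb{R}^d$, $\mathcal{H}_\alpha(x):=h_{\alpha_1}(x_1)\cdots h_{\alpha_d}(x_d)$ and $|\alpha|:=\alpha_1+\cdots+\alpha_d$. For an integer $n\ge 0$ set $$\mathcal{H}_n(x,y):=\sum_{|\alpha|=n}\mathcal{H}_\alpha(x)\mathcal{H}_\alpha(y),\qquad K_n(x,y):=\sum_{j=0}^n\mathcal{H}_j(x,y).$$ A function $\widehat a\in C^\infty[0,\infty)$ is admissible of type (a) if $\operatorname{supp}\widehat a\subset[0,1+v]$ for some $v>0$ and $\widehat a(t)=1$ on $[0,1]$; it is admissible of type (b) if $\operatorname{supp}\widehat a\subset[u,1+v]$, where $0<u<1$, $v>0$. For admissible $\widehat a$ and a positive integer $n$, $$\Lambda_n(x,y):=\sum_{j=0}^\infty\widehat a\Big(\frac jn\Big)\mathcal{H}_j(x,y),\qquad x,y\in\mathbb{R}^d.$$ For $x\in\mathbb{R}^d$, $|x|$ is the Euclidean norm; $[\cdot]$ denotes the integer part.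
   Formalization: The constant c(k,|α|,u,d) is allowed to depend also on the parameter v; independence of v is false (d=1, |α|=2, k=1, x=y=0, â=1 on [0,v] with bounded â' forces c ≥ const·(1+v)). *)

theory Defs
  imports "HOL-Analysis.Analysis"
begin

text \<open>Points of \<open>\<real>\<^sup>d\<close> have type \<^typ>\<open>real ^ 'd\<close> and multi-indices have type
  \<open>'d \<Rightarrow> nat\<close>, with \<open>d = CARD('d)\<close>.\<close>

definition hermite_H :: "nat \<Rightarrow> real \<Rightarrow> real" where
  "hermite_H n t = (-1) ^ n * exp (t\<^sup>2) * (deriv ^^ n) (\<lambda>s. exp (- s\<^sup>2)) t"

definition hermite_h :: "nat \<Rightarrow> real \<Rightarrow> real" where
  "hermite_h n t = (2 ^ n * fact n * sqrt pi) powr (- 1 / 2) * hermite_H n t * exp (- t\<^sup>2 / 2)"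

definition mi_size :: "('d::finite \<Rightarrow> nat) \<Rightarrow> nat" where
  "mi_size \<alpha> = (\<Sum>i\<in>UNIV. \<alpha> i)"

definition hermite_fun :: "('d::finite \<Rightarrow> nat) \<Rightarrow> real ^ 'd \<Rightarrow> real" where
  "hermite_fun \<alpha> x = (\<Prod>i\<in>UNIV. hermite_h (\<alpha> i) (x $ i))"

definition hermite_kernel :: "nat \<Rightarrow> real ^ 'd::finite \<Rightarrow> real ^ 'd \<Rightarrow> real" where
  "hermite_kernel n x y = (\<Sum>\<alpha> | mi_size \<alpha> = n. hermite_fun \<alpha> x * hermite_fun \<alpha> y)"

definition K_kernel :: "nat \<Rightarrow> real ^ 'd::finite \<Rightarrow> real ^ 'd \<Rightarrow> real" where
  "K_kernel n x y = (\<Sum>j\<le>n. hermite_kernel j x y)"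

text \<open>Functions on \<open>[0,\<infinity>)\<close> are total functions of which only the values on \<open>{0..}\<close> matter:
  derivatives are taken within \<open>{0..}\<close>, hence are one-sided at \<open>0\<close>. Cut-off functions may be
  complex-valued, which includes the real-valued ones.\<close>

definition half_line_deriv :: "nat \<Rightarrow> (real \<Rightarrow> complex) \<Rightarrow> real \<Rightarrow> complex" where
  "half_line_deriv l a = ((\<lambda>f t. vector_derivative f (at t within {0..})) ^^ l) a"

definition smooth_half_line :: "(real \<Rightarrow> complex) \<Rightarrow> bool" where
  "smooth_half_line a \<longleftrightarrow> (\<forall>l. half_line_deriv l a differentiable_on {0..})"

definition half_line_support :: "(real \<Rightarrow> complex) \<Rightarrow> real set" where
  "half_line_support a = closure {t. 0 \<le> t \<and> a t \<noteq> 0}"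

definition half_line_sup_norm :: "(real \<Rightarrow> complex) \<Rightarrow> real" where
  "half_line_sup_norm f = (SUP t\<in>{0..}. norm (f t))"

definition admissible_a :: "real \<Rightarrow> (real \<Rightarrow> complex) \<Rightarrow> bool" where
  "admissible_a v a \<longleftrightarrow> v > 0 \<and> smooth_half_line a \<and>
     half_line_support a \<subseteq> {0..1 + v} \<and> (\<forall>t\<in>{0..1}. a t = 1)"

definition admissible_b :: "real \<Rightarrow> real \<Rightarrow> (real \<Rightarrow> complex) \<Rightarrow> bool" where
  "admissible_b u v a \<longleftrightarrow> 0 < u \<and> u < 1 \<and> v > 0 \<and> smooth_half_line a \<and>
     half_line_support a \<subseteq> {u..1 + v}"

text \<open>Type (a) is given the parameter \<open>u = 1\<close> by convention; type (b) has \<open>u < 1\<close>.\<close>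

definition admissible :: "real \<Rightarrow> real \<Rightarrow> (real \<Rightarrow> complex) \<Rightarrow> bool" where
  "admissible u v a \<longleftrightarrow> u = 1 \<and> admissible_a v a \<or> admissible_b u v a"

text \<open>For \<open>a\<close> of bounded support and \<open>n \<ge> 1\<close>, only finitely many terms are nonzero.\<close>

definition Lambda_kernel ::
    "(real \<Rightarrow> complex) \<Rightarrow> nat \<Rightarrow> real ^ 'd::finite \<Rightarrow> real ^ 'd \<Rightarrow> complex" where
  "Lambda_kernel a n x y = (\<Sum>j. a (real j / real n) * of_real (hermite_kernel j x y))"

definition partial_deriv ::
    "'d::finite \<Rightarrow> (real ^ 'd \<Rightarrow> complex) \<Rightarrow> real ^ 'd \<Rightarrow> complex" where
  "partial_deriv i f x = vector_derivative (\<lambda>t. f (x + t *\<^sub>R axis i 1)) (at 0)"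

text \<open>The linear order on \<open>'d\<close> only fixes the order \<open>\<partial>\<^sub>1\<^bsup>\<alpha>\<^sub>1\<^esup> \<dots> \<partial>\<^sub>d\<^bsup>\<alpha>\<^sub>d\<^esup>\<close> in which the
  partial derivatives are taken.\<close>

definition partial_deriv_multi ::
    "('d::{finite,linorder} \<Rightarrow> nat) \<Rightarrow> ((real, 'd) vec \<Rightarrow> complex) \<Rightarrow> (real, 'd) vec \<Rightarrow> complex" where
  "partial_deriv_multi \<alpha> f =
     foldr (\<lambda>i. partial_deriv i ^^ \<alpha> i) (sorted_list_of_set UNIV) f"

end

theory Submission
  imports Defs
begin

text \<open>For fixed \<open>x\<close>, the family \<open>\<beta> \<mapsto> \<H>\<^sub>\<beta>(x)\<close> satisfies \<open>x\<^sub>i = (A\<^sub>i + A\<^sub>i\<^sup>+) / \<surd>2\<close> and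
  \<open>\<partial>\<^sub>i = (A\<^sub>i - A\<^sub>i\<^sup>+) / \<surd>2\<close>, where the ladder operators \<open>A\<^sub>i\<close>, \<open>A\<^sub>i\<^sup>+\<close> act on the multi-index, and
  \<open>\<Lambda>\<^sub>n(x, y)\<close> pairs the families of \<open>x\<close> and \<open>y\<close> with the weight \<open>g(j) = a(j / n)\<close>. Because \<open>A\<^sub>i\<close> is
  adjoint to \<open>A\<^sub>i\<^sup>+\<close> up to a shift of \<open>g\<close>, multiplying such a pairing by \<open>x\<^sub>i - y\<^sub>i\<close> either replaces
  \<open>g\<close> by its forward difference and adds one ladder operator, or (commutators) removes one ladder
  operator. By Cauchy--Schwarz a ladder operator costs \<open>n\<^sup>1\<^sup>/\<^sup>2\<close>, and by the mean value inequality
  a difference gains \<open>n\<^sup>-\<^sup>1\<close>; so every factor \<open>x\<^sub>i - y\<^sub>i\<close> gains \<open>n\<^sup>-\<^sup>1\<^sup>/\<^sup>2\<close>.\<close>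

section \<open>Hermite functions of one variable\<close>

text \<open>The Hermite polynomials through their three-term recurrence;
  \<open>hermite_H_eq_hermite_poly\<close> links them to the Rodrigues formula.\<close>

fun hermite_poly :: "nat \<Rightarrow> real \<Rightarrow> real" where
  "hermite_poly 0 t = 1"
| "hermite_poly (Suc 0) t = 2 * t"
| "hermite_poly (Suc (Suc n)) t = 2 * t * hermite_poly (Suc n) t - 2 * real (Suc n) * hermite_poly n t"

text \<open>At n = 0 the truncated index n - 1 is harmless because its coefficient vanishes; the
  ladder formulas below rely on the same convention.\<close>

lemma hermite_poly_Suc:
  "hermite_poly (Suc n) t = 2 * t * hermite_poly n t - 2 * real n * hermite_poly (n - 1) t"
  by (cases n) auto

text \<open>Differentiating the recurrence for H_{n+2} gives 2 H_{n+1} plus 2 (n + 1) times the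
  recurrence expression for H_{n+1}, in total 2 (n + 2) H_{n+1}.\<close>

lemma has_real_derivative_hermite_poly:
  "(hermite_poly n has_real_derivative 2 * real n * hermite_poly (n - 1) t) (at t)"
proof (induction n arbitrary: t rule: induct_nat_012)
  case 0
  show ?case by (auto intro!: derivative_eq_intros)
next
  case 1
  show ?case by (auto intro!: derivative_eq_intros)
next
  case (ge2 n)
  have "((\<lambda>t. 2 * t * hermite_poly (Suc n) t - 2 * real (Suc n) * hermite_poly n t) has_real_derivative
      2 * hermite_poly (Suc n) t + 2 * t * (2 * real (Suc n) * hermite_poly n t)
        - 2 * real (Suc n) * (2 * real n * hermite_poly (n - 1) t)) (at t)"
    using ge2 by (auto intro!: derivative_eq_intros)
  moreover have "2 * hermite_poly (Suc n) t + 2 * t * (2 * real (Suc n) * hermite_poly n t)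
        - 2 * real (Suc n) * (2 * real n * hermite_poly (n - 1) t)
      = 2 * real (Suc (Suc n)) * hermite_poly (Suc (Suc n) - 1) t"
    by (simp add: hermite_poly_Suc[of n t] algebra_simps)
  moreover have "hermite_poly (Suc (Suc n))
      = (\<lambda>t. 2 * t * hermite_poly (Suc n) t - 2 * real (Suc n) * hermite_poly n t)"
    by (simp add: fun_eq_iff)
  ultimately show ?case
    by (simp only:)
qed

text \<open>Differentiation turns the polynomial factor p into p' - 2 t p, which for H_n is
  -H_{n+1}.\<close>

lemma deriv_funpow_gaussian:
  "(deriv ^^ n) (\<lambda>s. exp (- s\<^sup>2)) = (\<lambda>t::real. (-1) ^ n * hermite_poly n t * exp (- t\<^sup>2))"
proof (induction n)
  case 0
  then show ?case by simp
next
  case (Suc n)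
  have "((\<lambda>t. (-1) ^ n * hermite_poly n t * exp (- t\<^sup>2)) has_real_derivative
      (-1) ^ Suc n * hermite_poly (Suc n) t * exp (- t\<^sup>2)) (at t)" for t
    by (auto intro!: derivative_eq_intros has_real_derivative_hermite_poly
        simp: hermite_poly_Suc algebra_simps)
  with Suc show ?case
    by (auto intro!: DERIV_imp_deriv)
qed

lemma hermite_H_eq_hermite_poly: "hermite_H n t = hermite_poly n t"
  by (simp add: hermite_H_def deriv_funpow_gaussian mult.assoc mult.left_commute
      flip: power_mult_distrib exp_add)

definition hermite_norm :: "nat \<Rightarrow> real" where
  "hermite_norm n = (2 ^ n * fact n * sqrt pi) powr (- 1 / 2)"

lemma hermite_h_eq: "hermite_h n t = hermite_norm n * hermite_poly n t * exp (- t\<^sup>2 / 2)"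
  by (simp add: hermite_h_def hermite_norm_def hermite_H_eq_hermite_poly)

lemma hermite_norm_eq: "hermite_norm n = 1 / sqrt (2 ^ n * fact n * sqrt pi)"
  unfolding hermite_norm_def by (simp add: powr_minus_divide powr_half_sqrt)

lemma hermite_norm_Suc: "hermite_norm n = sqrt (2 * real (Suc n)) * hermite_norm (Suc n)"
proof -
  have "(2::real) ^ Suc n * fact (Suc n) * sqrt pi = (2 * real (Suc n)) * (2 ^ n * fact n * sqrt pi)"
    by (simp add: algebra_simps)
  then show ?thesis
    unfolding hermite_norm_eq by (simp only: real_sqrt_mult) (simp add: field_simps)
qed

text \<open>The free factor \<open>z\<close> lets the identity act as a rewrite rule inside
  products; at n = 0 both sides vanish.\<close>

lemma hermite_norm_pred:
  "2 * real n * (hermite_norm n * z) = sqrt (2 * real n) * (hermite_norm (n - 1) * z)"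
proof (cases n)
  case (Suc m)
  have "sqrt (2 * real n) * sqrt (2 * real n) = 2 * real n" by simp
  then show ?thesis unfolding Suc by (simp add: hermite_norm_Suc[of m] mult.assoc[symmetric])
qed simp

text \<open>Normalising H_n balances the recurrence coefficients: multiplication by t becomes a
  symmetric tridiagonal operator on the index.\<close>

lemma times_hermite_h:
  "t * hermite_h n t = (sqrt (real n) * hermite_h (n - 1) t + sqrt (real n + 1) * hermite_h (n + 1) t) / sqrt 2"
proof -
  define e where "e = exp (- t\<^sup>2 / 2)"
  have "2 * (t * hermite_h n t)
      = hermite_norm n * hermite_poly (n + 1) t * e + 2 * real n * (hermite_norm n * (hermite_poly (n - 1) t * e))"
    unfolding hermite_h_eq e_def by (simp add: hermite_poly_Suc[of n t] algebra_simps)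
  also have "\<dots> = sqrt (2 * (real n + 1)) * hermite_h (n + 1) t + sqrt (2 * real n) * hermite_h (n - 1) t"
    unfolding hermite_norm_pred hermite_h_eq e_def by (simp add: hermite_norm_Suc[of n] add.commute)
  finally have "sqrt 2 * (sqrt 2 * (t * hermite_h n t))
      = sqrt 2 * (sqrt (real n) * hermite_h (n - 1) t + sqrt (real n + 1) * hermite_h (n + 1) t)"
    by (simp only: real_sqrt_mult mult.assoc[symmetric]) (simp add: algebra_simps)
  then have "sqrt 2 * (t * hermite_h n t)
      = sqrt (real n) * hermite_h (n - 1) t + sqrt (real n + 1) * hermite_h (n + 1) t"
    by (simp only: mult_cancel_left) simp
  then show ?thesis
    by (simp add: field_simps)
qed

text \<open>The product rule gives sqrt (2 n) h_{n-1} - t h_n; expanding t h_n by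
  \<open>times_hermite_h\<close> yields the antisymmetric combination.\<close>

lemma has_real_derivative_hermite_h:
  "(hermite_h n has_real_derivative
     (sqrt (real n) * hermite_h (n - 1) t - sqrt (real n + 1) * hermite_h (n + 1) t) / sqrt 2) (at t)"
proof -
  define e where "e = exp (- t\<^sup>2 / 2)"
  have "((\<lambda>t. hermite_norm n * hermite_poly n t * exp (- t\<^sup>2 / 2)) has_real_derivative
      2 * real n * (hermite_norm n * (hermite_poly (n - 1) t * e)) - t * hermite_h n t) (at t)"
    unfolding hermite_h_eq e_def
    by (auto intro!: derivative_eq_intros has_real_derivative_hermite_poly simp: algebra_simps)
  moreover have "2 * real n * (hermite_norm n * (hermite_poly (n - 1) t * e)) = sqrt (2 * real n) * hermite_h (n - 1) t"
    unfolding hermite_norm_pred hermite_h_eq e_def by simp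
  moreover have "sqrt (2 * real n) * hermite_h (n - 1) t - t * hermite_h n t
      = (sqrt (real n) * hermite_h (n - 1) t - sqrt (real n + 1) * hermite_h (n + 1) t) / sqrt 2"
    unfolding times_hermite_h by (simp add: real_sqrt_mult field_simps)
  moreover have "hermite_h n = (\<lambda>t. hermite_norm n * hermite_poly n t * exp (- t\<^sup>2 / 2))"
    by (simp add: fun_eq_iff hermite_h_eq)
  ultimately show ?thesis
    by (simp only:)
qed

section \<open>Ladder operators on families indexed by multi-indices\<close>

type_synonym 'd mi = "'d \<Rightarrow> nat"

lemma component_le_mi_size: "\<beta> j \<le> mi_size \<beta>"
  unfolding mi_size_def by (rule member_le_sum) auto

lemma finite_mi_size_le: "finite {\<beta> :: 'd::finite mi. mi_size \<beta> \<le> N}"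
proof -
  have "{\<beta> :: 'd mi. mi_size \<beta> \<le> N} \<subseteq> {\<beta>. \<forall>i. (i \<in> UNIV \<longrightarrow> \<beta> i \<in> {..N}) \<and> (i \<notin> UNIV \<longrightarrow> \<beta> i = 0)}"
    using component_le_mi_size by (auto intro: order_trans)
  then show ?thesis
    by (rule finite_subset) (rule finite_set_of_finite_funs, auto)
qed

lemma mi_size_fun_upd: "mi_size (\<beta>(j := m)) + \<beta> j = mi_size \<beta> + m"
proof -
  have "mi_size \<gamma> = \<gamma> j + (\<Sum>i\<in>UNIV - {j}. \<gamma> i)" for \<gamma> :: "'a mi"
    unfolding mi_size_def by (rule sum.remove) auto
  from this[of \<beta>] this[of "\<beta>(j := m)"] show ?thesis by simp
qed

lemma mi_size_inc: "mi_size (\<beta>(j := \<beta> j + 1)) = mi_size \<beta> + 1"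
  using mi_size_fun_upd[of \<beta> j "\<beta> j + 1"] by simp

lemma mi_size_dec: "\<beta> j \<noteq> 0 \<Longrightarrow> mi_size (\<beta>(j := \<beta> j - 1)) + 1 = mi_size \<beta>"
  using mi_size_fun_upd[of \<beta> j "\<beta> j - 1"] by simp

text \<open>Named after the index at which \<open>\<phi>\<close> is read: on families this is the
  creation operator, and \<open>raise\<close> is the annihilation operator. At
  \<open>\<beta> j = 0\<close> the truncated index carries the coefficient 0.\<close>

definition lower :: "'d::finite \<Rightarrow> ('d mi \<Rightarrow> real) \<Rightarrow> 'd mi \<Rightarrow> real" where
  "lower j \<phi> \<beta> = sqrt (real (\<beta> j)) * \<phi> (\<beta>(j := \<beta> j - 1))"

definition raise :: "'d::finite \<Rightarrow> ('d mi \<Rightarrow> real) \<Rightarrow> 'd mi \<Rightarrow> real" where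
  "raise j \<phi> \<beta> = sqrt (real (\<beta> j) + 1) * \<phi> (\<beta>(j := \<beta> j + 1))"

text \<open>One format for position, derivative and pure raising, so that a single estimate covers
  every operator that arises.\<close>

fun ladder :: "'d::finite \<times> real \<times> real \<Rightarrow> ('d mi \<Rightarrow> real) \<Rightarrow> 'd mi \<Rightarrow> real" where
  "ladder (j, s, t) \<phi> \<beta> = s * lower j \<phi> \<beta> + t * raise j \<phi> \<beta>"

text \<open>The head of the list acts last; a letter appended at the end acts directly on
  \<open>\<phi>\<close>.\<close>

fun word :: "('d::finite \<times> real \<times> real) list \<Rightarrow> ('d mi \<Rightarrow> real) \<Rightarrow> 'd mi \<Rightarrow> real" where
  "word [] \<phi> = \<phi>"
| "word (L # ws) \<phi> = ladder L (word ws \<phi>)"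

text \<open>On the Hermite family of x, \<open>pos i\<close> is multiplication by x_i, and
  \<open>diff_letter i\<close> encodes the partial derivative in direction i.\<close>

abbreviation pos :: "'d::finite \<Rightarrow> ('d mi \<Rightarrow> real) \<Rightarrow> 'd mi \<Rightarrow> real" where
  "pos i \<equiv> ladder (i, 1 / sqrt 2, 1 / sqrt 2)"

abbreviation diff_letter :: "'d \<Rightarrow> 'd \<times> real \<times> real" where
  "diff_letter i \<equiv> (i, 1 / sqrt 2, - (1 / sqrt 2))"

lemma ladder_add: "ladder L (\<lambda>\<beta>. \<phi> \<beta> + \<psi> \<beta>) = (\<lambda>\<beta>. ladder L \<phi> \<beta> + ladder L \<psi> \<beta>)"
  by (cases L) (auto simp: lower_def raise_def algebra_simps)

lemma ladder_scale: "ladder L (\<lambda>\<beta>. c * \<phi> \<beta>) = (\<lambda>\<beta>. c * ladder L \<phi> \<beta>)"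
  by (cases L) (auto simp: lower_def raise_def algebra_simps)

lemma ladder_sum: "ladder L (\<lambda>\<beta>. \<Sum>r\<in>R. \<phi> r \<beta>) = (\<lambda>\<beta>. \<Sum>r\<in>R. ladder L (\<phi> r) \<beta>)"
proof -
  obtain j s t where "L = (j, s, t)" by (cases L)
  then show ?thesis
    by (simp add: lower_def raise_def fun_eq_iff sum_distrib_left flip: sum.distrib)
qed

lemma word_scale: "word ws (\<lambda>\<beta>. c * \<phi> \<beta>) = (\<lambda>\<beta>. c * word ws \<phi> \<beta>)"
  by (induction ws) (auto simp: ladder_scale)

text \<open>Together with \<open>raise_lower\<close>: both products are diagonal with entries
  differing by 1, the canonical commutation relation.\<close>

lemma lower_raise: "lower i (raise i \<phi>) \<beta> = real (\<beta> i) * \<phi> \<beta>"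
proof (cases "\<beta> i")
  case (Suc m)
  then have "\<beta>(i := Suc m) = \<beta>" by auto
  with Suc show ?thesis
    by (simp add: lower_def raise_def mult.assoc[symmetric] add.commute)
qed (simp add: lower_def)

lemma raise_lower: "raise i (lower i \<phi>) \<beta> = (real (\<beta> i) + 1) * \<phi> \<beta>"
  by (auto simp: lower_def raise_def mult.assoc[symmetric] add.commute)

text \<open>The commutator of \<open>pos i\<close> with a letter is this scalar; letters in
  different directions commute.\<close>

definition comm_const :: "'d \<Rightarrow> 'd \<times> real \<times> real \<Rightarrow> real" where
  "comm_const i L = (case L of (j, s, t) \<Rightarrow> if i = j then (s - t) / sqrt 2 else 0)"

lemma lower_raise_ladder: 
  "lower i (ladder (j, s, t) \<phi>) \<beta> = s * lower i (lower j \<phi>) \<beta> + t * lower i (raise j \<phi>) \<beta>"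
  "raise i (ladder (j, s, t) \<phi>) \<beta> = s * raise i (lower j \<phi>) \<beta> + t * raise i (raise j \<phi>) \<beta>"
  by (simp_all add: lower_def raise_def algebra_simps)

lemma ladder_commute_neq:
  assumes "i \<noteq> j"
  shows "lower i (lower j \<phi>) \<beta> = lower j (lower i \<phi>) \<beta>"
    and "lower i (raise j \<phi>) \<beta> = raise j (lower i \<phi>) \<beta>"
    and "raise i (raise j \<phi>) \<beta> = raise j (raise i \<phi>) \<beta>"
  using assms by (simp_all add: lower_def raise_def fun_upd_twist[OF assms, of \<beta>])

lemma pos_ladder: "pos i (ladder L \<phi>) \<beta> = ladder L (pos i \<phi>) \<beta> + comm_const i L * \<phi> \<beta>"
proof -
  obtain j s t where L: "L = (j, s, t)" by (cases L)
  show ?thesis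
  proof (cases "i = j")
    case True
    then show ?thesis
      unfolding L ladder.simps(1)[of i] ladder.simps(1)[of j] lower_raise_ladder
      by (simp add: lower_raise raise_lower comm_const_def field_simps)
  next
    case False
    then show ?thesis
      unfolding L ladder.simps(1)[of i] ladder.simps(1)[of j] lower_raise_ladder
      by (simp add: ladder_commute_neq[OF False] ladder_commute_neq(2)[OF False[symmetric]] comm_const_def algebra_simps)
  qed
qed

definition delete_nth :: "nat \<Rightarrow> 'a list \<Rightarrow> 'a list" where
  "delete_nth r xs = take r xs @ drop (Suc r) xs"

text \<open>A Leibniz rule: \<open>pos i\<close> moves inwards past one letter at a time, and each
  letter passed leaves a scalar commutator in its place.\<close>

lemma pos_word:
  "pos i (word ws \<phi>) \<beta> = word ws (pos i \<phi>) \<beta>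
     + (\<Sum>r<length ws. comm_const i (ws ! r) * word (delete_nth r ws) \<phi> \<beta>)"
proof (induction ws arbitrary: \<beta>)
  case Nil
  then show ?case by simp
next
  case (Cons L ws)
  have "pos i (word (L # ws) \<phi>) \<beta> = ladder L (pos i (word ws \<phi>)) \<beta> + comm_const i L * word ws \<phi> \<beta>"
    by (simp only: word.simps pos_ladder)
  also have "pos i (word ws \<phi>) = (\<lambda>\<beta>. word ws (pos i \<phi>) \<beta>
     + (\<Sum>r<length ws. comm_const i (ws ! r) * word (delete_nth r ws) \<phi> \<beta>))"
    using Cons.IH by blast
  \<comment> \<open>Index 0 of the shifted sum is the commutator with \<open>L\<close>, whose
    deletion leaves \<open>ws\<close>.\<close>
  finally show ?case
    unfolding length_Cons sum.lessThan_Suc_shift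
    by (simp del: ladder.simps add: ladder_add ladder_sum ladder_scale delete_nth_def)
qed

section \<open>Pairings weighted by a function of the degree\<close>

text \<open>Truncation at degree \<open>N\<close> makes the sum finite; for a weight vanishing above
  \<open>N\<close> it is the full pairing.\<close>

definition pairing ::
    "nat \<Rightarrow> (nat \<Rightarrow> complex) \<Rightarrow> ('d::finite mi \<Rightarrow> real) \<Rightarrow> ('d mi \<Rightarrow> real) \<Rightarrow> complex" where
  "pairing N g \<phi> \<psi> = (\<Sum>\<beta> | mi_size \<beta> \<le> N. g (mi_size \<beta>) * of_real (\<phi> \<beta> * \<psi> \<beta>))"

lemma pairing_commute: "pairing N g \<phi> \<psi> = pairing N g \<psi> \<phi>"
  by (simp add: pairing_def mult.commute)

lemma pairing_add: "pairing N g (\<lambda>\<beta>. \<phi> \<beta> + \<phi>' \<beta>) \<psi> = pairing N g \<phi> \<psi> + pairing N g \<phi>' \<psi>"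
  by (simp add: pairing_def algebra_simps sum.distrib)

lemma pairing_scale: "pairing N g (\<lambda>\<beta>. c * \<phi> \<beta>) \<psi> = of_real c * pairing N g \<phi> \<psi>"
  by (simp add: pairing_def algebra_simps sum_distrib_left)

lemma pairing_sum: "pairing N g (\<lambda>\<beta>. \<Sum>r\<in>R. \<phi> r \<beta>) \<psi> = (\<Sum>r\<in>R. pairing N g (\<phi> r) \<psi>)"
  by (simp add: pairing_def sum_distrib_left sum_distrib_right sum.swap[of _ _ R])

text \<open>Adjointness by the substitution \<beta> -> \<beta> - e_j; the degree drops by one, which
  shifts the weight.\<close>

lemma pairing_lower:
  assumes "g (Suc N) = 0"
  shows "pairing N g (lower j \<phi>) \<psi> = pairing N (\<lambda>m. g (Suc m)) \<phi> (raise j \<psi>)"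
proof -
  have "pairing N g (lower j \<phi>) \<psi>
      = (\<Sum>\<beta> | mi_size \<beta> \<le> N \<and> \<beta> j \<noteq> 0. g (mi_size \<beta>) * of_real (lower j \<phi> \<beta> * \<psi> \<beta>))"
    unfolding pairing_def
    by (rule sum.mono_neutral_right) (auto simp: finite_mi_size_le lower_def)
  also have "\<dots> = (\<Sum>\<beta> | mi_size \<beta> < N. g (Suc (mi_size \<beta>)) * of_real (\<phi> \<beta> * raise j \<psi> \<beta>))"
  proof (rule sum.reindex_bij_witness[where i = "\<lambda>\<beta>. \<beta>(j := \<beta> j + 1)" and j = "\<lambda>\<beta>. \<beta>(j := \<beta> j - 1)"])
    fix \<beta> :: "'a mi"
    assume "\<beta> \<in> {\<beta>. mi_size \<beta> \<le> N \<and> \<beta> j \<noteq> 0}"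
    then have b: "mi_size \<beta> \<le> N" "\<beta> j \<noteq> 0" by auto
    show inv: "(\<beta>(j := \<beta> j - 1))(j := (\<beta>(j := \<beta> j - 1)) j + 1) = \<beta>"
      using b by auto
    show "\<beta>(j := \<beta> j - 1) \<in> {\<beta>. mi_size \<beta> < N}"
      using b mi_size_dec[of \<beta> j] by auto
    have "Suc (mi_size (\<beta>(j := \<beta> j - 1))) = mi_size \<beta>"
      using b mi_size_dec[of \<beta> j] by auto
    moreover have "raise j \<psi> (\<beta>(j := \<beta> j - 1)) = sqrt (real (\<beta> j)) * \<psi> \<beta>"
      unfolding raise_def inv using b by (simp add: of_nat_diff)
    ultimately show "g (Suc (mi_size (\<beta>(j := \<beta> j - 1)))) *
        complex_of_real (\<phi> (\<beta>(j := \<beta> j - 1)) * raise j \<psi> (\<beta>(j := \<beta> j - 1)))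
        = g (mi_size \<beta>) * complex_of_real (lower j \<phi> \<beta> * \<psi> \<beta>)"
      by (simp add: lower_def)
  next
    fix \<beta> :: "'a mi"
    assume "\<beta> \<in> {\<beta>. mi_size \<beta> < N}"
    then show "\<beta>(j := \<beta> j + 1) \<in> {\<beta>. mi_size \<beta> \<le> N \<and> \<beta> j \<noteq> 0}"
      using mi_size_inc[of \<beta> j] by auto
  qed auto
  \<comment> \<open>The layer of degree exactly \<open>N\<close> is not reached by the reindexing;
    there the weight is \<open>g (Suc N) = 0\<close>.\<close>
  also have "\<dots> = pairing N (\<lambda>m. g (Suc m)) \<phi> (raise j \<psi>)"
    unfolding pairing_def
  proof (rule sum.mono_neutral_left)
    show "\<forall>\<beta>\<in>{\<beta>. mi_size \<beta> \<le> N} - {\<beta>. mi_size \<beta> < N}.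
        g (Suc (mi_size \<beta>)) * complex_of_real (\<phi> \<beta> * raise j \<psi> \<beta>) = 0"
      using assms by (auto simp: not_less dest: antisym)
  qed (auto simp: finite_mi_size_le)
  finally show ?thesis .
qed

definition diff1 :: "(nat \<Rightarrow> complex) \<Rightarrow> nat \<Rightarrow> complex" where
  "diff1 g m = g (Suc m) - g m"

lemma pairing_diff1: "pairing N (diff1 g) \<phi> \<psi> = pairing N (\<lambda>m. g (Suc m)) \<phi> \<psi> - pairing N g \<phi> \<psi>"
  by (simp add: pairing_def diff1_def sum_subtractf left_diff_distrib)

text \<open>Moving only the lowering half of \<open>pos i\<close> across gives raising terms with
  weight \<open>g\<close> or its shift; they match in pairs up to a difference of the
  weight.\<close>

lemma pairing_pos:
  assumes "g (Suc N) = 0"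
  shows "pairing N g (pos i \<phi>) \<psi> - pairing N g \<phi> (pos i \<psi>)
    = of_real (1 / sqrt 2) * (pairing N (diff1 g) \<phi> (raise i \<psi>) - pairing N (diff1 g) (raise i \<phi>) \<psi>)"
proof -
  have p: "pairing N g (pos i \<phi>) \<psi>
      = of_real (1 / sqrt 2) * (pairing N (\<lambda>m. g (Suc m)) \<phi> (raise i \<psi>) + pairing N g (raise i \<phi>) \<psi>)"
    for \<phi> \<psi> :: "'a mi \<Rightarrow> real"
    using pairing_lower[of g N i \<phi> \<psi>, OF assms]
    by (simp only: ladder.simps[abs_def] pairing_add pairing_scale distrib_left)
  show ?thesis
    unfolding pairing_diff1 p pairing_commute[of N g \<phi> "pos i \<psi>"]
    by (simp add: pairing_commute[of N _ "raise i \<phi>"] pairing_commute[of N _ "raise i \<psi>"] algebra_simps)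
qed

lemma pairing_pos_word:
  "pairing N g (pos i (word us \<phi>)) \<psi> = pairing N g (word us (pos i \<phi>)) \<psi>
     + (\<Sum>r<length us. of_real (comm_const i (us ! r)) * pairing N g (word (delete_nth r us) \<phi>) \<psi>)"
  unfolding pos_word[abs_def] pairing_add pairing_sum pairing_scale ..

section \<open>Norm estimates\<close>

abbreviation sq_sum :: "nat \<Rightarrow> ('d::finite mi \<Rightarrow> real) \<Rightarrow> real" where
  "sq_sum N \<phi> \<equiv> \<Sum>\<beta> | mi_size \<beta> \<le> N. (\<phi> \<beta>)\<^sup>2"

text \<open>The map \<beta> -> \<beta> - e_j is injective where \<beta>_j is nonzero, and the
  squared coefficient is \<beta>_j, at most N.\<close>

lemma sq_sum_lower: "sq_sum N (lower j \<phi>) \<le> real N * sq_sum N \<phi>"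
proof -
  have "sq_sum N (lower j \<phi>) = (\<Sum>\<beta> | mi_size \<beta> \<le> N \<and> \<beta> j \<noteq> 0. (lower j \<phi> \<beta>)\<^sup>2)"
    by (rule sum.mono_neutral_right) (auto simp: finite_mi_size_le lower_def)
  also have "\<dots> \<le> (\<Sum>\<beta> | mi_size \<beta> \<le> N. real N * (\<phi> \<beta>)\<^sup>2)"
  proof (rule sum_le_included[where i = "\<lambda>\<beta>. \<beta>(j := \<beta> j + 1)"])
    show "finite {\<beta> :: 'a mi. mi_size \<beta> \<le> N \<and> \<beta> j \<noteq> 0}"
      by (rule finite_subset[OF _ finite_mi_size_le[of N]]) auto
    show "\<forall>\<beta>\<in>{\<beta>. mi_size \<beta> \<le> N \<and> \<beta> j \<noteq> 0}. \<exists>\<gamma>\<in>{\<beta>. mi_size \<beta> \<le> N}.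
        \<gamma>(j := \<gamma> j + 1) = \<beta> \<and> (lower j \<phi> \<beta>)\<^sup>2 \<le> real N * (\<phi> \<gamma>)\<^sup>2"
    proof
      fix \<beta> :: "'a mi"
      assume "\<beta> \<in> {\<beta>. mi_size \<beta> \<le> N \<and> \<beta> j \<noteq> 0}"
      then have b: "mi_size \<beta> \<le> N" "\<beta> j \<noteq> 0" "\<beta> j \<le> N"
        using component_le_mi_size[of \<beta> j] by auto
      show "\<exists>\<gamma>\<in>{\<beta>. mi_size \<beta> \<le> N}. \<gamma>(j := \<gamma> j + 1) = \<beta> \<and> (lower j \<phi> \<beta>)\<^sup>2 \<le> real N * (\<phi> \<gamma>)\<^sup>2"
        using b mi_size_dec[of \<beta> j]
        by (intro bexI[of _ "\<beta>(j := \<beta> j - 1)"]) (auto simp: lower_def power_mult_distrib intro!: mult_right_mono)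
    qed
  qed (auto simp: finite_mi_size_le)
  finally show ?thesis
    by (simp add: sum_distrib_left)
qed

text \<open>Entries are read one degree higher, so the truncation must grow by one; this is the
  source of the enlarged degrees of K in the theorem.\<close>

lemma sq_sum_raise: "sq_sum N (raise j \<phi>) \<le> (real N + 1) * sq_sum (N + 1) \<phi>"
proof -
  have "sq_sum N (raise j \<phi>) \<le> (\<Sum>\<beta> | mi_size \<beta> \<le> N + 1. (real N + 1) * (\<phi> \<beta>)\<^sup>2)"
  proof (rule sum_le_included[where i = "\<lambda>\<beta>. \<beta>(j := \<beta> j - 1)"])
    show "\<forall>\<beta>\<in>{\<beta>. mi_size \<beta> \<le> N}. \<exists>\<gamma>\<in>{\<beta>. mi_size \<beta> \<le> N + 1}.
        \<gamma>(j := \<gamma> j - 1) = \<beta> \<and> (raise j \<phi> \<beta>)\<^sup>2 \<le> (real N + 1) * (\<phi> \<gamma>)\<^sup>2"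
    proof
      fix \<beta> :: "'a mi"
      assume "\<beta> \<in> {\<beta>. mi_size \<beta> \<le> N}"
      then have b: "mi_size \<beta> \<le> N" "\<beta> j \<le> N"
        using component_le_mi_size[of \<beta> j] by auto
      show "\<exists>\<gamma>\<in>{\<beta>. mi_size \<beta> \<le> N + 1}. \<gamma>(j := \<gamma> j - 1) = \<beta> \<and> (raise j \<phi> \<beta>)\<^sup>2 \<le> (real N + 1) * (\<phi> \<gamma>)\<^sup>2"
        using b mi_size_inc[of \<beta> j]
        by (intro bexI[of _ "\<beta>(j := \<beta> j + 1)"]) (auto simp: raise_def power_mult_distrib intro!: mult_right_mono)
    qed
  qed (auto simp: finite_mi_size_le)
  then show ?thesis
    by (simp add: sum_distrib_left)
qed

lemma sq_sum_mono: "M \<le> N \<Longrightarrow> sq_sum M \<phi> \<le> sq_sum N \<phi>"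
  by (rule sum_mono2) (auto simp: finite_mi_size_le)

lemma sq_sum_nonneg: "0 \<le> sq_sum N \<phi>"
  by (rule sum_nonneg) auto

text \<open>Contains pure raising (0, 1) and the derivative letters with coefficients of size 1 /
  sqrt 2.\<close>

definition unit_letters :: "('d \<times> real \<times> real) set" where
  "unit_letters = {(j, s, t). \<bar>s\<bar> \<le> 1 \<and> \<bar>t\<bar> \<le> 1}"

text \<open>The factor 4 is 2 from (a + b)^2 \<le> 2 (a^2 + b^2) times 2 for the two halves.\<close>

lemma sq_sum_ladder:
  assumes "L \<in> unit_letters"
  shows "sq_sum N (ladder L \<phi>) \<le> 4 * (real N + 1) * sq_sum (N + 1) \<phi>"
proof -
  obtain j s t where L: "L = (j, s, t)" "\<bar>s\<bar> \<le> 1" "\<bar>t\<bar> \<le> 1"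
    using assms by (auto simp: unit_letters_def)
  have "(s * a + t * b)\<^sup>2 \<le> 2 * (a\<^sup>2 + b\<^sup>2)" for a b
  proof -
    have "0 \<le> (s * a - t * b)\<^sup>2" by simp
    then have "(s * a + t * b)\<^sup>2 \<le> 2 * (s\<^sup>2 * a\<^sup>2 + t\<^sup>2 * b\<^sup>2)"
      by (simp add: power2_eq_square algebra_simps)
    also have "\<dots> \<le> 2 * (1 * a\<^sup>2 + 1 * b\<^sup>2)"
      using L by (intro mult_left_mono add_mono mult_right_mono) (auto simp: abs_square_le_1)
    finally show ?thesis by simp
  qed
  then have "sq_sum N (ladder L \<phi>) \<le> (\<Sum>\<beta> | mi_size \<beta> \<le> N. 2 * ((lower j \<phi> \<beta>)\<^sup>2 + (raise j \<phi> \<beta>)\<^sup>2))"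
    unfolding L by (intro sum_mono) simp
  also have "\<dots> = 2 * (sq_sum N (lower j \<phi>) + sq_sum N (raise j \<phi>))"
    by (simp add: sum.distrib sum_distrib_left)
  also have "\<dots> \<le> 2 * ((real N + 1) * sq_sum (N + 1) \<phi> + (real N + 1) * sq_sum (N + 1) \<phi>)"
  proof -
    have "real N * sq_sum N \<phi> \<le> (real N + 1) * sq_sum (N + 1) \<phi>"
      by (intro mult_mono sq_sum_mono sq_sum_nonneg) auto
    then show ?thesis
      using sq_sum_lower[where N = N and j = j and \<phi> = \<phi>] sq_sum_raise[where N = N and j = j and \<phi> = \<phi>] by simp
  qed
  finally show ?thesis by (simp add: algebra_simps)
qed

text \<open>The successive letters cost 4 (N + 1), 4 (N + 2), and so on; \<open>C\<close> dominates
  the last and largest of these.\<close>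

lemma sq_sum_word:
  assumes "set ws \<subseteq> unit_letters" "4 * real (N + length ws) \<le> C"
  shows "sq_sum N (word ws \<phi>) \<le> C ^ length ws * sq_sum (N + length ws) \<phi>"
  using assms
proof (induction ws arbitrary: N)
  case Nil
  then show ?case by simp
next
  case (Cons L ws)
  have C: "4 * (real N + 1) \<le> C" "0 \<le> C" using Cons.prems by auto
  have "sq_sum N (word (L # ws) \<phi>) \<le> 4 * (real N + 1) * sq_sum (N + 1) (word ws \<phi>)"
    using Cons.prems sq_sum_ladder[where N = N and L = L and \<phi> = "word ws \<phi>"] by simp
  also have "\<dots> \<le> C * (C ^ length ws * sq_sum (N + 1 + length ws) \<phi>)"
    using C Cons.prems by (intro mult_mono Cons.IH sq_sum_nonneg) auto
  finally show ?case by (simp add: algebra_simps)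
qed

text \<open>Cauchy-Schwarz, after bounding the weight termwise.\<close>

lemma norm_pairing_le:
  assumes "\<And>m. m \<le> N \<Longrightarrow> norm (g m) \<le> M" "0 \<le> M"
  shows "norm (pairing N g \<phi> \<psi>) \<le> M * (sqrt (sq_sum N \<phi>) * sqrt (sq_sum N \<psi>))"
proof -
  have "norm (pairing N g \<phi> \<psi>) \<le> (\<Sum>\<beta> | mi_size \<beta> \<le> N. M * (\<bar>\<phi> \<beta>\<bar> * \<bar>\<psi> \<beta>\<bar>))"
    unfolding pairing_def
    using assms by (intro sum_norm_le) (auto simp: norm_mult intro!: mult_right_mono)
  also have "\<dots> = M * (\<Sum>\<beta> | mi_size \<beta> \<le> N. \<bar>\<phi> \<beta>\<bar> * \<bar>\<psi> \<beta>\<bar>)"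
    by (simp add: sum_distrib_left)
  also have "\<dots> \<le> M * (sqrt (sq_sum N \<phi>) * sqrt (sq_sum N \<psi>))"
    using assms(2) L2_set_mult_ineq[of \<phi> \<psi>] unfolding L2_set_def by (intro mult_left_mono) auto
  finally show ?thesis .
qed

section \<open>Decay of pairings of Hermite functions\<close>

abbreviation hermite_family :: "real ^ 'd::finite \<Rightarrow> 'd mi \<Rightarrow> real" where
  "hermite_family x \<equiv> \<lambda>\<beta>. hermite_fun \<beta> x"

lemma hermite_fun_fun_upd:
  "hermite_fun (\<beta>(j := m)) x = hermite_h m (x $ j) * (\<Prod>i\<in>UNIV - {j}. hermite_h (\<beta> i) (x $ i))"
proof -
  have "hermite_fun (\<beta>(j := m)) x = hermite_h m (x $ j) * (\<Prod>i\<in>UNIV - {j}. hermite_h ((\<beta>(j := m)) i) (x $ i))"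
    unfolding hermite_fun_def by (subst prod.remove[of _ j]) auto
  then show ?thesis by simp
qed

lemma hermite_fun_split:
  "hermite_fun \<beta> x = hermite_h (\<beta> j) (x $ j) * (\<Prod>i\<in>UNIV - {j}. hermite_h (\<beta> i) (x $ i))"
  using hermite_fun_fun_upd[of \<beta> j "\<beta> j" x] by simp

lemma pos_hermite_family: "pos i (hermite_family x) = (\<lambda>\<beta>. x $ i * hermite_fun \<beta> x)"
proof
  fix \<beta>
  have "x $ i * hermite_fun \<beta> x
      = (x $ i * hermite_h (\<beta> i) (x $ i)) * (\<Prod>l\<in>UNIV - {i}. hermite_h (\<beta> l) (x $ l))"
    by (simp add: hermite_fun_split[of \<beta> x i])
  then show "pos i (hermite_family x) \<beta> = x $ i * hermite_fun \<beta> x"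
    by (simp add: times_hermite_h lower_def raise_def hermite_fun_fun_upd field_simps)
qed

lemma abs_comm_const_le:
  assumes "L \<in> unit_letters"
  shows "\<bar>comm_const i L\<bar> \<le> 2"
proof -
  obtain j s t where L: "L = (j, s, t)" "\<bar>s\<bar> \<le> 1" "\<bar>t\<bar> \<le> 1"
    using assms by (auto simp: unit_letters_def)
  have "\<bar>s - t\<bar> / sqrt 2 \<le> 2 / 1"
    using L by (intro frac_le) auto
  then show ?thesis
    by (simp add: L(1) comm_const_def)
qed

lemma length_delete_nth: "r < length xs \<Longrightarrow> Suc (length (delete_nth r xs)) = length xs"
  by (simp add: delete_nth_def)

lemma set_delete_nth: "set (delete_nth r xs) \<subseteq> set xs"
  unfolding delete_nth_def by (auto dest: in_set_takeD in_set_dropD)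

text \<open>The factor x_i enters the family of x as \<open>pos i\<close> and is pulled out of its
  word at the price of commutators; likewise y_i. The two outer \<open>pos i\<close> then combine by
  \<open>pairing_pos\<close>.\<close>

lemma times_pairing_words:
  fixes x y :: "real ^ 'd::finite" and N :: nat
  defines "T \<equiv> \<lambda>g us ws. pairing N g (word us (hermite_family x)) (word ws (hermite_family y))"
  assumes "g (Suc N) = 0"
  shows "of_real (x $ i - y $ i) * T g us ws
    = of_real (1 / sqrt 2) * (T (diff1 g) us ((i, 0, 1) # ws) - T (diff1 g) ((i, 0, 1) # us) ws)
      - (\<Sum>r<length us. of_real (comm_const i (us ! r)) * T g (delete_nth r us) ws)
      + (\<Sum>r<length ws. of_real (comm_const i (ws ! r)) * T g us (delete_nth r ws))"
proof -
  \<comment> \<open>Reading \<open>raise i\<close> as the letter (i, 0, 1) keeps all terms pairings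
    of words, so the identity can be iterated.\<close>
  have raise: "word ((i, 0, 1) # vs) \<phi> = raise i (word vs \<phi>)" for vs and \<phi> :: "'d mi \<Rightarrow> real"
    by auto
  have "of_real (x $ i) * T g us ws = pairing N g (word us (pos i (hermite_family x))) (word ws (hermite_family y))"
    unfolding T_def pos_hermite_family word_scale pairing_scale ..
  also have "\<dots> = pairing N g (pos i (word us (hermite_family x))) (word ws (hermite_family y))
      - (\<Sum>r<length us. of_real (comm_const i (us ! r)) * T g (delete_nth r us) ws)"
    unfolding pairing_pos_word T_def by (simp del: ladder.simps)
  finally have x: "of_real (x $ i) * T g us ws = \<dots>" .
  have "of_real (y $ i) * T g us ws = pairing N g (word ws (pos i (hermite_family y))) (word us (hermite_family x))"
    unfolding T_def pos_hermite_family word_scale pairing_scale pairing_commute[of N g "word ws _"] ..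
  also have "\<dots> = pairing N g (pos i (word ws (hermite_family y))) (word us (hermite_family x))
      - (\<Sum>r<length ws. of_real (comm_const i (ws ! r)) * T g us (delete_nth r ws))"
    unfolding pairing_pos_word T_def
    by (simp del: ladder.simps add: pairing_commute[of N g _ "word us _"])
  finally have y: "of_real (y $ i) * T g us ws = \<dots>" .
  have "of_real (x $ i - y $ i) * T g us ws = of_real (x $ i) * T g us ws - of_real (y $ i) * T g us ws"
    by (simp add: algebra_simps)
  also have "\<dots> = (pairing N g (pos i (word us (hermite_family x))) (word ws (hermite_family y))
        - pairing N g (word us (hermite_family x)) (pos i (word ws (hermite_family y))))
      - (\<Sum>r<length us. of_real (comm_const i (us ! r)) * T g (delete_nth r us) ws)
      + (\<Sum>r<length ws. of_real (comm_const i (ws ! r)) * T g us (delete_nth r ws))"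
    unfolding x y pairing_commute[of N g "pos i (word ws _)"] by (simp del: ladder.simps)
  also have "pairing N g (pos i (word us (hermite_family x))) (word ws (hermite_family y))
        - pairing N g (word us (hermite_family x)) (pos i (word ws (hermite_family y)))
      = of_real (1 / sqrt 2) * (T (diff1 g) us ((i, 0, 1) # ws) - T (diff1 g) ((i, 0, 1) # us) ws)"
    unfolding pairing_pos[of g N i, OF assms(2)] T_def raise ..
  finally show ?thesis .
qed

text \<open>A forward difference only looks at larger arguments, so vanishing above \<open>N\<close>
  persists.\<close>

lemma funpow_diff1_eq_0:
  assumes "\<And>m. N < m \<Longrightarrow> g m = 0" "N < m"
  shows "(diff1 ^^ l) g m = 0"
  using assms(2) by (induction l arbitrary: m) (auto simp: assms(1) diff1_def)

text \<open>Grouping by degree; this is how K(x, x) emerges from Cauchy-Schwarz.\<close>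

lemma K_kernel_diag: "K_kernel N x x = sq_sum N (hermite_family x)"
proof -
  have "(\<Sum>j\<in>{..N}. \<Sum>\<beta>\<in>{\<beta> \<in> {\<beta>. mi_size \<beta> \<le> N}. mi_size \<beta> = j}. hermite_fun \<beta> x * hermite_fun \<beta> x)
      = (\<Sum>\<beta>\<in>{\<beta>. mi_size \<beta> \<le> N}. hermite_fun \<beta> x * hermite_fun \<beta> x)"
    by (rule sum.group) (auto simp: finite_mi_size_le)
  moreover have "{\<beta> \<in> {\<beta> :: 'a mi. mi_size \<beta> \<le> N}. mi_size \<beta> = j} = {\<beta>. mi_size \<beta> = j}" if "j \<le> N" for j
    using that by auto
  ultimately show ?thesis
    by (simp add: K_kernel_def hermite_kernel_def power2_eq_square)
qed

lemma sqrt_sq_sum_word_le: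
  assumes "set ws \<subseteq> unit_letters" "length ws \<le> P" "4 * real (N + P) \<le> E * s\<^sup>2" "1 \<le> E" "0 < s"
  shows "sqrt (sq_sum N (word ws (hermite_family x))) \<le> E ^ P * s ^ length ws * sqrt (K_kernel (N + P) x x)"
proof -
  let ?p = "length ws"
  have "sq_sum N (word ws (hermite_family x)) \<le> (E * s\<^sup>2) ^ ?p * sq_sum (N + ?p) (hermite_family x)"
    using assms by (intro sq_sum_word) auto
  also have "\<dots> \<le> (E * s\<^sup>2) ^ ?p * K_kernel (N + P) x x"
    unfolding K_kernel_diag using assms by (intro mult_left_mono sq_sum_mono) auto
  also have "(E * s\<^sup>2) ^ ?p = E ^ ?p * (s ^ ?p)\<^sup>2"
    by (simp add: power_mult_distrib power_mult[symmetric] mult.commute)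
  \<comment> \<open>The power of \<open>E\<close> is enlarged to an even exponent independent of the
    word, while the power of \<open>s\<close> stays exact for the later bookkeeping.\<close>
  also have "E ^ ?p * (s ^ ?p)\<^sup>2 * K_kernel (N + P) x x \<le> E ^ (2 * P) * (s ^ ?p)\<^sup>2 * K_kernel (N + P) x x"
    unfolding K_kernel_diag using assms by (intro mult_right_mono power_increasing sq_sum_nonneg) auto
  also have "E ^ (2 * P) * (s ^ ?p)\<^sup>2 = (E ^ P * s ^ ?p)\<^sup>2"
    by (simp add: power_mult_distrib power_mult[symmetric] mult.commute)
  finally have "sqrt (sq_sum N (word ws (hermite_family x))) \<le> sqrt ((E ^ P * s ^ ?p)\<^sup>2 * K_kernel (N + P) x x)"
    by (rule real_sqrt_le_mono)
  also have "\<dots> = E ^ P * s ^ ?p * sqrt (K_kernel (N + P) x x)"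
    using assms by (simp add: real_sqrt_mult)
  finally show ?thesis .
qed

text \<open>With \<open>s = \<surd>n\<close>, each difference is worth \<open>s\<^sup>-\<^sup>2\<close> and each ladder operator \<open>s\<close>, so each of
  the terms produced by one multiplication with \<open>x\<^sub>i - y\<^sub>i\<close> gains exactly one factor \<open>s\<^sup>-\<^sup>1\<close>.\<close>

lemma pairing_words_decay:
  fixes x y :: "real ^ 'd::finite"
  assumes g0: "\<And>m. N < m \<Longrightarrow> g m = 0"
    and gb: "\<And>l m. l \<le> k \<Longrightarrow> norm ((diff1 ^^ l) g m) \<le> M / s ^ (2 * l)"
    and M: "0 \<le> M" and s: "0 < s" and E: "1 \<le> E"
    and EP: "4 * real (N + P) \<le> E * s\<^sup>2" and EQ: "4 * real (N + Q) \<le> E * s\<^sup>2"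
  defines "B \<equiv> M * (E ^ P * sqrt (K_kernel (N + P) x x)) * (E ^ Q * sqrt (K_kernel (N + Q) y y))"
  assumes "set us \<subseteq> unit_letters" "set ws \<subseteq> unit_letters"
    and "l + m \<le> k" "length us + m \<le> P" "length ws + m \<le> Q"
  shows "\<bar>x $ i - y $ i\<bar> ^ m
      * norm (pairing N ((diff1 ^^ l) g) (word us (hermite_family x)) (word ws (hermite_family y)))
    \<le> (2 + 2 * real P + 2 * real Q) ^ m * B * s ^ (length us + length ws) / s ^ (2 * l + m)"
  using assms(9-)
\<comment> \<open>Each multiplication uses up at most one difference and one letter on each side;
  the hypotheses reserve a budget of \<open>m\<close> for both.\<close>
proof (induction m arbitrary: l us ws)
  case 0
  let ?U = "sqrt (sq_sum N (word us (hermite_family x)))" and ?W = "sqrt (sq_sum N (word ws (hermite_family y)))"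
  have "norm (pairing N ((diff1 ^^ l) g) (word us (hermite_family x)) (word ws (hermite_family y)))
      \<le> M / s ^ (2 * l) * (?U * ?W)"
    using 0 M s by (intro norm_pairing_le gb) auto
  also have "\<dots> \<le> M / s ^ (2 * l) * ((E ^ P * s ^ length us * sqrt (K_kernel (N + P) x x))
      * (E ^ Q * s ^ length ws * sqrt (K_kernel (N + Q) y y)))"
  proof -
    have "?U \<le> E ^ P * s ^ length us * sqrt (K_kernel (N + P) x x)"
      using 0 s E EP by (intro sqrt_sq_sum_word_le) auto
    moreover have "?W \<le> E ^ Q * s ^ length ws * sqrt (K_kernel (N + Q) y y)"
      using 0 s E EQ by (intro sqrt_sq_sum_word_le) auto
    moreover have "0 \<le> ?U" "0 \<le> ?W" "0 \<le> E ^ P * s ^ length us * sqrt (K_kernel (N + P) x x)"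
      using s E by (auto simp: K_kernel_diag sq_sum_nonneg)
    ultimately show ?thesis
      using M s by (intro mult_left_mono mult_mono) auto
  qed
  also have "\<dots> = B * s ^ (length us + length ws) / s ^ (2 * l)"
    by (simp add: B_def power_add field_simps)
  finally show ?case by simp
next
  case (Suc m)
  define d where "d = x $ i - y $ i"
  define T where "T = (\<lambda>l us ws. pairing N ((diff1 ^^ l) g) (word us (hermite_family x)) (word ws (hermite_family y)))"
  define R where "R = 2 + 2 * real P + 2 * real Q"
  \<comment> \<open>The common bound for every term produced by the last multiplication.\<close>
  define X where "X = R ^ m * B * s ^ (length us + length ws) / s ^ (2 * l + Suc m)"
  have "0 \<le> B"
    unfolding B_def using M E by (auto simp: K_kernel_diag intro!: mult_nonneg_nonneg sq_sum_nonneg)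
  then have X: "0 \<le> X"
    unfolding X_def R_def using s by auto
  have raise: "(i, 0, 1) \<in> unit_letters" by (simp add: unit_letters_def)
  \<comment> \<open>The length condition encodes the gain of one power of \<open>s\<close>: it holds
    for one more difference with one more letter, and for one letter deleted.\<close>
  have IH: "\<bar>d\<bar> ^ m * norm (T l' us' ws') \<le> X"
    if "set us' \<subseteq> unit_letters" "set ws' \<subseteq> unit_letters" "l' + m \<le> k" "length us' + m \<le> P"
      "length ws' + m \<le> Q" "length us' + length ws' + 2 * l + 1 = length us + length ws + 2 * l'"
    for l' us' ws'
  proof -
    have "\<bar>d\<bar> ^ m * norm (T l' us' ws') \<le> R ^ m * B * s ^ (length us' + length ws') / s ^ (2 * l' + m)"
      using Suc.IH[of us' ws' l'] that unfolding d_def T_def R_def by simp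
    also have "s ^ (length us' + length ws') / s ^ (2 * l' + m) = s ^ (length us + length ws) / s ^ (2 * l + Suc m)"
    proof -
      have "s ^ (length us' + length ws') * s ^ (2 * l + Suc m) = s ^ (length us + length ws) * s ^ (2 * l' + m)"
        unfolding power_add[symmetric] by (rule arg_cong[where f = "\<lambda>e. s ^ e"]) (use that in linarith)
      with s show ?thesis by (simp add: frac_eq_eq)
    qed
    then have "R ^ m * B * s ^ (length us' + length ws') / s ^ (2 * l' + m) = X"
      unfolding X_def by (simp add: times_divide_eq_right[symmetric] del: times_divide_eq_right)
    finally show ?thesis .
  qed
  let ?c = "\<lambda>L. complex_of_real (comm_const i L)"
  have del: "\<bar>d\<bar> ^ m * norm (\<Sum>r<length vs. ?c (vs ! r) * t r) \<le> length vs * (2 * X)"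
    if vs: "set vs \<subseteq> unit_letters" and t: "\<And>r. r < length vs \<Longrightarrow> \<bar>d\<bar> ^ m * norm (t r) \<le> X" for vs t
  proof -
    have "\<bar>d\<bar> ^ m * norm (\<Sum>r<length vs. ?c (vs ! r) * t r) \<le> \<bar>d\<bar> ^ m * (\<Sum>r<length vs. norm (?c (vs ! r) * t r))"
      by (intro mult_left_mono norm_sum) auto
    also have "\<dots> = (\<Sum>r<length vs. \<bar>comm_const i (vs ! r)\<bar> * (\<bar>d\<bar> ^ m * norm (t r)))"
      by (simp add: sum_distrib_left norm_mult algebra_simps)
    also have "\<dots> \<le> (\<Sum>r<length vs. 2 * X)"
      using vs by (intro sum_mono mult_mono t abs_comm_const_le) (auto intro: nth_mem)
    finally show ?thesis by simp
  qed
  have gN: "(diff1 ^^ l) g (Suc N) = 0"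
    by (rule funpow_diff1_eq_0[OF g0]) auto
  have "\<bar>d\<bar> ^ Suc m * norm (T l us ws) = \<bar>d\<bar> ^ m * norm (of_real d * T l us ws)"
    by (simp add: norm_mult)
  also have "of_real d * T l us ws = of_real (1 / sqrt 2) * (T (Suc l) us ((i, 0, 1) # ws) - T (Suc l) ((i, 0, 1) # us) ws)
      - (\<Sum>r<length us. ?c (us ! r) * T l (delete_nth r us) ws)
      + (\<Sum>r<length ws. ?c (ws ! r) * T l us (delete_nth r ws))" (is "_ = ?k * (?t1 - ?t2) - ?s1 + ?s2")
    unfolding d_def T_def times_pairing_words[of "(diff1 ^^ l) g" N, OF gN] funpow.simps comp_apply ..
  also have "\<bar>d\<bar> ^ m * norm (?k * (?t1 - ?t2) - ?s1 + ?s2)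
      \<le> \<bar>d\<bar> ^ m * (norm ?t1 + norm ?t2 + norm ?s1 + norm ?s2)"
  proof (intro mult_left_mono)
    have "norm (?k * (?t1 - ?t2)) = (1 / sqrt 2) * norm (?t1 - ?t2)"
      by (simp add: norm_mult norm_divide)
    also have "\<dots> \<le> 1 * norm (?t1 - ?t2)"
      by (intro mult_right_mono) auto
    also have "\<dots> \<le> norm ?t1 + norm ?t2"
      using norm_triangle_ineq4 by simp
    finally show "norm (?k * (?t1 - ?t2) - ?s1 + ?s2) \<le> norm ?t1 + norm ?t2 + norm ?s1 + norm ?s2"
      using norm_triangle_ineq[of "?k * (?t1 - ?t2) - ?s1" ?s2] norm_triangle_ineq4[of "?k * (?t1 - ?t2)" ?s1]
      by linarith
  qed auto
  also have "\<dots> = \<bar>d\<bar> ^ m * norm ?t1 + \<bar>d\<bar> ^ m * norm ?t2 + \<bar>d\<bar> ^ m * norm ?s1 + \<bar>d\<bar> ^ m * norm ?s2"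
    by (simp add: algebra_simps)
  also have "\<dots> \<le> X + X + length us * (2 * X) + length ws * (2 * X)"
  proof -
    have "\<bar>d\<bar> ^ m * norm ?t1 \<le> X" "\<bar>d\<bar> ^ m * norm ?t2 \<le> X"
      using Suc.prems raise by (intro IH; simp)+
    moreover have "\<bar>d\<bar> ^ m * norm ?s1 \<le> length us * (2 * X)"
    proof (intro del IH)
      fix r assume "r < length us"
      then show "length (delete_nth r us) + length ws + 2 * l + 1 = length us + length ws + 2 * l"
        "length (delete_nth r us) + m \<le> P"
        using Suc.prems length_delete_nth[of r us] by linarith+
      show "set (delete_nth r us) \<subseteq> unit_letters"
        by (rule subset_trans[OF set_delete_nth Suc.prems(1)])
    qed (use Suc.prems in simp_all)
    moreover have "\<bar>d\<bar> ^ m * norm ?s2 \<le> length ws * (2 * X)"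
    proof (intro del IH)
      fix r assume "r < length ws"
      then show "length us + length (delete_nth r ws) + 2 * l + 1 = length us + length ws + 2 * l"
        "length (delete_nth r ws) + m \<le> Q"
        using Suc.prems length_delete_nth[of r ws] by linarith+
      show "set (delete_nth r ws) \<subseteq> unit_letters"
        by (rule subset_trans[OF set_delete_nth Suc.prems(2)])
    qed (use Suc.prems in simp_all)
    ultimately show ?thesis by linarith
  qed
  also have "\<dots> = (2 + 2 * real (length us) + 2 * real (length ws)) * X"
    by (simp add: algebra_simps)
  \<comment> \<open>\<open>R\<close> counts the two difference terms and, with weight 2 for the
    commutator scalars, at most \<open>P\<close> and \<open>Q\<close> deletions.\<close>
  also have "\<dots> \<le> R * X"
    unfolding R_def using Suc.prems X by (intro mult_right_mono) auto
  also have "R * X = R ^ Suc m * B * s ^ (length us + length ws) / s ^ (2 * l + Suc m)"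
    by (simp add: X_def)
  finally show ?case
    unfolding d_def T_def R_def .
qed

section \<open>Partial derivatives of the pairings\<close>

lemma has_real_derivative_hermite_fun:
  "((\<lambda>t. hermite_fun \<beta> (x + t *\<^sub>R axis j 1)) has_real_derivative
     ladder (diff_letter j) (hermite_family x) \<beta>) (at 0)"
proof -
  define p where "p = (\<Prod>i\<in>UNIV - {j}. hermite_h (\<beta> i) (x $ i))"
  let ?D = "(sqrt (real (\<beta> j)) * hermite_h (\<beta> j - 1) (x $ j)
      - sqrt (real (\<beta> j) + 1) * hermite_h (\<beta> j + 1) (x $ j)) / sqrt 2"
  have "hermite_fun \<beta> (x + t *\<^sub>R axis j 1) = hermite_h (\<beta> j) (x $ j + t) * p" for t
    unfolding hermite_fun_split[of \<beta> _ j] p_def by (simp add: axis_def)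
  moreover have "(hermite_h (\<beta> j) has_real_derivative ?D) (at (x $ j + 0))"
    using has_real_derivative_hermite_h[of "\<beta> j" "x $ j"] by simp
  then have "((\<lambda>t. hermite_h (\<beta> j) (x $ j + t)) has_real_derivative ?D * 1) (at 0)"
    by (rule DERIV_chain2) (auto intro!: derivative_eq_intros)
  then have "((\<lambda>t. hermite_h (\<beta> j) (x $ j + t) * p) has_real_derivative ?D * p) (at 0)"
    by (auto intro!: derivative_eq_intros)
  moreover have "?D * p = ladder (diff_letter j) (hermite_family x) \<beta>"
    by (simp add: lower_def raise_def hermite_fun_fun_upd p_def field_simps)
  ultimately show ?thesis by simp
qed

text \<open>The letters do not depend on the point, so the derivative falls on the Hermite family
  itself and its letter is appended at the inner end.\<close>

lemma has_real_derivative_word: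
  "((\<lambda>t. word ws (hermite_family (x + t *\<^sub>R axis j 1)) \<beta>) has_real_derivative
     word (ws @ [diff_letter j]) (hermite_family x) \<beta>) (at 0)"
proof (induction ws arbitrary: \<beta>)
  case Nil
  then show ?case
    using has_real_derivative_hermite_fun[of \<beta> x j] by (simp del: ladder.simps)
next
  case (Cons L ws)
  obtain l s t where L: "L = (l, s, t)" by (cases L)
  show ?case
    unfolding append_Cons word.simps L ladder.simps lower_def raise_def
    by (intro DERIV_add DERIV_cmult Cons.IH)
qed

lemma partial_deriv_pairing:
  "partial_deriv j (\<lambda>z. pairing N g (word ws (hermite_family z)) \<psi>)
    = (\<lambda>z. pairing N g (word (ws @ [diff_letter j]) (hermite_family z)) \<psi>)"
proof
  fix x
  have "((\<lambda>t. pairing N g (word ws (hermite_family (x + t *\<^sub>R axis j 1))) \<psi>) has_vector_derivative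
      pairing N g (word (ws @ [diff_letter j]) (hermite_family x)) \<psi>) (at 0)"
    unfolding pairing_def
    by (intro has_vector_derivative_sum has_vector_derivative_mult_right has_vector_derivative_of_real
        DERIV_cmult_right has_real_derivative_word)
  then show "partial_deriv j (\<lambda>z. pairing N g (word ws (hermite_family z)) \<psi>) x
      = pairing N g (word (ws @ [diff_letter j]) (hermite_family x)) \<psi>"
    unfolding partial_deriv_def by (rule vector_derivative_at)
qed

lemma funpow_partial_deriv_pairing:
  "(partial_deriv j ^^ m) (\<lambda>z. pairing N g (word ws (hermite_family z)) \<psi>)
    = (\<lambda>z. pairing N g (word (ws @ replicate m (diff_letter j)) (hermite_family z)) \<psi>)"
  by (induction m) (simp_all add: partial_deriv_pairing replicate_append_same del: replicate_Suc flip: replicate_Suc)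

lemma partial_deriv_multi_pairing:
  fixes \<alpha> :: "'d::{finite,linorder} \<Rightarrow> nat"
  obtains ws where "length ws = mi_size \<alpha>" "set ws \<subseteq> unit_letters"
    "partial_deriv_multi \<alpha> (\<lambda>z. pairing N g (hermite_family z) \<psi>)
      = (\<lambda>z. pairing N g (word ws (hermite_family z)) \<psi>)"
proof -
  \<comment> \<open>Generalised to an arbitrary list of directions for the induction along
    \<open>foldr\<close>.\<close>
  have "\<exists>ws. length ws = sum_list (map \<alpha> js) \<and> set ws \<subseteq> unit_letters \<and>
      foldr (\<lambda>i. partial_deriv i ^^ \<alpha> i) js (\<lambda>z. pairing N g (hermite_family z) \<psi>)
      = (\<lambda>z. pairing N g (word ws (hermite_family z)) \<psi>)" for js
  proof (induction js)
    case Nil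
    show ?case by (rule exI[of _ "[]"]) simp
  next
    case (Cons j js)
    then obtain ws where "length ws = sum_list (map \<alpha> js)" "set ws \<subseteq> unit_letters"
      "foldr (\<lambda>i. partial_deriv i ^^ \<alpha> i) js (\<lambda>z. pairing N g (hermite_family z) \<psi>)
      = (\<lambda>z. pairing N g (word ws (hermite_family z)) \<psi>)" by blast
    then show ?case
      by (intro exI[of _ "ws @ replicate (\<alpha> j) (diff_letter j)"])
        (auto simp: funpow_partial_deriv_pairing unit_letters_def)
  qed
  moreover have "sum_list (map \<alpha> (sorted_list_of_set UNIV)) = mi_size \<alpha>"
    unfolding mi_size_def by (simp add: sum_list_distinct_conv_sum_set)
  ultimately show thesis
    using that unfolding partial_deriv_multi_def by metis
qed

text \<open>The series stops at \<open>N\<close>, and the multi-indices regroup by degree.\<close>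

lemma Lambda_kernel_eq_pairing:
  assumes "\<And>j. N < j \<Longrightarrow> a (real j / real n) = 0"
  shows "Lambda_kernel a n x y = pairing N (\<lambda>j. a (real j / real n)) (hermite_family x) (hermite_family y)"
proof -
  have "Lambda_kernel a n x y = (\<Sum>j\<le>N. a (real j / real n) * of_real (hermite_kernel j x y))"
    unfolding Lambda_kernel_def by (rule suminf_finite) (auto simp: assms not_le)
  also have "\<dots> = (\<Sum>j\<in>{..N}. \<Sum>\<beta>\<in>{\<beta> \<in> {\<beta>. mi_size \<beta> \<le> N}. mi_size \<beta> = j}.
      a (real (mi_size \<beta>) / real n) * of_real (hermite_fun \<beta> x * hermite_fun \<beta> y))"
  proof (rule sum.cong)
    fix j assume "j \<in> {..N}"
    then have "{\<beta> \<in> {\<beta> :: 'a mi. mi_size \<beta> \<le> N}. mi_size \<beta> = j} = {\<beta>. mi_size \<beta> = j}" by auto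
    then show "a (real j / real n) * of_real (hermite_kernel j x y)
        = (\<Sum>\<beta>\<in>{\<beta> \<in> {\<beta>. mi_size \<beta> \<le> N}. mi_size \<beta> = j}.
          a (real (mi_size \<beta>) / real n) * of_real (hermite_fun \<beta> x * hermite_fun \<beta> y))"
      by (simp add: hermite_kernel_def sum_distrib_left)
  qed simp
  also have "\<dots> = pairing N (\<lambda>j. a (real j / real n)) (hermite_family x) (hermite_family y)"
    unfolding pairing_def by (rule sum.group) (auto simp: finite_mi_size_le)
  finally show ?thesis .
qed

section \<open>Differences of samples of the cut-off function\<close>

lemma norm_forward_difference_le:
  fixes f :: "real \<Rightarrow> complex"
  assumes "\<And>t. 0 \<le> t \<Longrightarrow> (f has_vector_derivative f' t) (at t within {0..})"
    and "\<And>t. 0 \<le> t \<Longrightarrow> norm (f' t) \<le> B" and "0 \<le> t" "0 \<le> h"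
  shows "norm (f (t + h) - f t) \<le> B * h"
proof -
  have "norm (f (t + h) - f t) \<le> B * norm ((t + h) - t)"
  proof (rule differentiable_bound[where S = "{0..}" and f' = "\<lambda>t d. d *\<^sub>R f' t"])
    show "(f has_derivative (\<lambda>d. d *\<^sub>R f' r)) (at r within {0..})" if "r \<in> {0..}" for r
      using assms(1) that by (simp add: has_vector_derivative_def)
    show "onorm (\<lambda>d. d *\<^sub>R f' r) \<le> B" if "r \<in> {0..}" for r
    proof (rule onorm_bound)
      have "norm (f' r) \<le> B" using assms(2) that by simp
      then show "norm (d *\<^sub>R f' r) \<le> B * norm d" for d
        by (simp add: mult.commute[of B] mult_left_mono)
      then show "0 \<le> B" using norm_ge_zero[of "f' r"] \<open>norm (f' r) \<le> B\<close> by linarith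
    qed
  qed (use assms in auto)
  then show ?thesis using assms(4) by simp
qed

text \<open>\<open>D\<close> is a chain of successive derivatives. Its differences with step
  \<open>h\<close> form such a chain \<open>D'\<close>, and the mean value inequality bounds
  \<open>D' l\<close> by \<open>B * h\<close> from the bound on \<open>D (Suc l)\<close>; so the
  induction runs over all chains.\<close>

lemma norm_funpow_diff1_le:
  assumes "\<And>j t. 0 \<le> t \<Longrightarrow> (D j has_vector_derivative D (Suc j) t) (at t within {0..})"
    and "\<And>t. 0 \<le> t \<Longrightarrow> norm (D l t) \<le> B" and "0 < h"
  shows "norm ((diff1 ^^ l) (\<lambda>m. D 0 (real m * h)) m) \<le> B * h ^ l"
  using assms(1,2)
proof (induction l arbitrary: D B)
  case 0
  then show ?case using assms(3) by simp
next
  case (Suc l)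
  define D' where "D' = (\<lambda>j t. D j (t + h) - D j t)"
  have "((\<lambda>t. D j (t + h)) has_vector_derivative D (Suc j) (t + h)) (at t within {0..})" if "0 \<le> t" for j t
  proof -
    \<comment> \<open>The shift maps the half-line into itself, so one-sided derivatives at 0 cause
      no trouble.\<close>
    have "(D j has_vector_derivative D (Suc j) (t + h)) (at (t + h) within (\<lambda>t. t + h) ` {0..})"
      using that assms(3) by (intro has_vector_derivative_within_subset[OF Suc.prems(1)]) auto
    from vector_diff_chain_within[OF _ this, of 1] show ?thesis
      by (simp add: comp_def has_vector_derivative_add_const has_vector_derivative_id)
  qed
  then have "(D' j has_vector_derivative D' (Suc j) t) (at t within {0..})" if "0 \<le> t" for j t
    unfolding D'_def using that by (intro has_vector_derivative_diff Suc.prems(1))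
  moreover have "norm (D' l t) \<le> B * h" if "0 \<le> t" for t
    unfolding D'_def using that assms(3) Suc.prems by (intro norm_forward_difference_le[where f' = "D (Suc l)"]) auto
  ultimately have "norm ((diff1 ^^ l) (\<lambda>m. D' 0 (real m * h)) m) \<le> B * h * h ^ l"
    by (rule Suc.IH)
  moreover have "diff1 (\<lambda>m. D 0 (real m * h)) = (\<lambda>m. D' 0 (real m * h))"
    by (simp add: diff1_def D'_def fun_eq_iff algebra_simps)
  ultimately show ?case
    by (simp add: funpow_Suc_right del: funpow.simps)
qed

lemma half_line_deriv_Suc:
  "half_line_deriv (Suc l) a t = vector_derivative (half_line_deriv l a) (at t within {0..})"
  by (simp add: half_line_deriv_def)

lemma half_line_deriv_has_vector_derivative:
  assumes "smooth_half_line a" "0 \<le> t"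
  shows "(half_line_deriv l a has_vector_derivative half_line_deriv (Suc l) a t) (at t within {0..})"
  using assms unfolding smooth_half_line_def half_line_deriv_Suc differentiable_on_def
  by (auto simp: vector_derivative_works)

lemma half_line_deriv_eq_0:
  assumes "\<And>t. b < t \<Longrightarrow> a t = 0" "0 \<le> b" "b < t"
  shows "half_line_deriv l a t = 0"
  using assms(3)
proof (induction l arbitrary: t)
  case 0
  then show ?case using assms(1) by (simp add: half_line_deriv_def)
next
  case (Suc l)
  have "(half_line_deriv l a has_vector_derivative 0) (at t)"
    by (rule has_vector_derivative_transform_within_open[of "\<lambda>_. 0" _ _ "{b<..}"])
      (use Suc in \<open>auto simp: has_vector_derivative_const\<close>)
  \<comment> \<open>Since t > b \<ge> 0 is an interior point, the derivative within the half-line is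
    the ordinary one.\<close>
  moreover have "at t within {0..} = at t"
    using assms(2) Suc.prems by (intro at_within_interior) auto
  ultimately show ?case
    by (simp add: half_line_deriv_Suc vector_derivative_at)
qed

text \<open>A real supremum is an upper bound only for a bounded set: the derivative is continuous
  on the compact interval up to \<open>b\<close> and zero beyond.\<close>

lemma norm_le_half_line_sup_norm:
  assumes "smooth_half_line a" "\<And>t. b < t \<Longrightarrow> a t = 0" "0 \<le> b" "0 \<le> t"
  shows "norm (half_line_deriv l a t) \<le> half_line_sup_norm (half_line_deriv l a)"
proof -
  have "continuous_on {0..b} (half_line_deriv l a)"
    using assms(1) unfolding smooth_half_line_def
    by (meson Icc_subset_Ici_iff differentiable_imp_continuous_on differentiable_on_subset order_refl)
  then have "bounded (half_line_deriv l a ` {0..b})"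
    by (intro compact_imp_bounded compact_continuous_image) auto
  then obtain C where "\<forall>z\<in>half_line_deriv l a ` {0..b}. norm z \<le> C"
    unfolding bounded_iff by (rule exE)
  then have C: "norm (half_line_deriv l a t) \<le> C" if "t \<in> {0..b}" for t
    using that by blast
  have "norm (half_line_deriv l a t) \<le> max C 0" if "0 \<le> t" for t
    using C[of t] half_line_deriv_eq_0[of b a t l] assms that by (cases "t \<le> b") auto
  then have "bdd_above ((\<lambda>t. norm (half_line_deriv l a t)) ` {0..})"
    by (intro bdd_aboveI[of _ "max C 0"]) auto
  then show ?thesis
    unfolding half_line_sup_norm_def using assms(4) by (intro cSUP_upper) auto
qed

lemma admissible_cutoff:
  assumes "admissible u v a"
  shows "0 < v" "smooth_half_line a" "\<And>t. 1 + v < t \<Longrightarrow> a t = 0"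
proof -
  show v: "0 < v" and "smooth_half_line a"
    using assms by (auto simp: admissible_def admissible_a_def admissible_b_def)
  fix t :: real
  assume t: "1 + v < t"
  have "half_line_support a \<subseteq> {..1 + v}"
    using assms by (auto simp: admissible_def admissible_a_def admissible_b_def)
  moreover have "t \<in> half_line_support a" if "a t \<noteq> 0"
    unfolding half_line_support_def using that t v by (intro subsetD[OF closure_subset]) auto
  ultimately show "a t = 0"
    using t by fastforce
qed

section \<open>Assembling coordinatewise decay into the final bound\<close>

text \<open>The norm is at most d times the largest coordinate, and (1 + q)^k \<le> 2^k (1 + q^k);
  \<open>A\<close> controls the constant term and \<open>C\<close> the power.\<close>

lemma one_plus_norm_power_le:
  fixes w :: "real ^ 'd::finite"
  assumes "0 \<le> V" "0 \<le> s" "V \<le> A" "\<And>i. (s * \<bar>w $ i\<bar>) ^ k * V \<le> C"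
  shows "V * (1 + s * norm w) ^ k \<le> 2 ^ k * (A + real CARD('d) ^ k * C)"
proof -
  have "Max (range (\<lambda>j. \<bar>w $ j\<bar>)) \<in> range (\<lambda>j. \<bar>w $ j\<bar>)"
    by (rule Max_in) auto
  then obtain i where "Max (range (\<lambda>j. \<bar>w $ j\<bar>)) = \<bar>w $ i\<bar>"
    by (rule imageE)
  then have i: "\<bar>w $ j\<bar> \<le> \<bar>w $ i\<bar>" for j
    using Max_ge[of "range (\<lambda>j. \<bar>w $ j\<bar>)" "\<bar>w $ j\<bar>"] by simp
  define q where "q = real CARD('d) * (s * \<bar>w $ i\<bar>)"
  have "norm w \<le> (\<Sum>j\<in>UNIV. \<bar>w $ j\<bar>)" by (rule norm_le_l1_cart)
  also have "\<dots> \<le> real CARD('d) * \<bar>w $ i\<bar>"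
    using sum_bounded_above[of UNIV "\<lambda>j. \<bar>w $ j\<bar>" "\<bar>w $ i\<bar>"] i by simp
  finally have "s * norm w \<le> q"
    unfolding q_def using assms(2) by (simp add: mult_left_mono algebra_simps)
  moreover have q: "0 \<le> q" unfolding q_def using assms(2) by auto
  ultimately have "(1 + s * norm w) ^ k \<le> (2 * max 1 q) ^ k"
    using assms(2) by (intro power_mono) auto
  also have "\<dots> \<le> 2 ^ k * (1 + q ^ k)"
    unfolding power_mult_distrib using q by (intro mult_left_mono) (auto simp: max_def)
  finally have "V * (1 + s * norm w) ^ k \<le> V * (2 ^ k * (1 + q ^ k))"
    using assms(1) by (intro mult_left_mono)
  also have "\<dots> = 2 ^ k * (V + real CARD('d) ^ k * ((s * \<bar>w $ i\<bar>) ^ k * V))"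
    by (simp add: q_def power_mult_distrib algebra_simps)
  also have "\<dots> \<le> 2 ^ k * (A + real CARD('d) ^ k * C)"
    using assms by (intro mult_left_mono add_mono) auto
  finally show ?thesis .
qed

text \<open>The theorem with the denominator multiplied out. \<open>N\<close> bounds the degrees of
  surviving terms, \<open>E\<close> absorbs the cost of letters relative to n, and \<open>R\<close>
  counts terms per multiplication.\<close>

lemma partial_deriv_Lambda_kernel_bound:
  fixes \<alpha> :: "'d::{finite,linorder} \<Rightarrow> nat" and x y :: "(real, 'd) vec" and k n :: nat
  assumes adm: "admissible u v a" and n: "n \<ge> 1"
  defines "p \<equiv> mi_size \<alpha>"
  defines "P \<equiv> p + k" and "N \<equiv> n + nat \<lfloor>v * real n\<rfloor>" and "s \<equiv> sqrt (real n)"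
  defines "R \<equiv> 2 + 2 * real P + 2 * real k" and "E \<equiv> 4 * (1 + v + real P)"
  defines "M \<equiv> MAX l\<in>{0..k}. half_line_sup_norm (half_line_deriv l a)"
  shows "norm (partial_deriv_multi \<alpha> (\<lambda>z. Lambda_kernel a n z y) x) * (1 + s * norm (x - y)) ^ k
    \<le> 2 ^ k * (1 + (real CARD('d) * R) ^ k) * E ^ (P + k) * M
      * (s ^ p * sqrt (K_kernel (N + P) x x) * sqrt (K_kernel (N + k) y y))"
proof -
  note a = admissible_cutoff[OF adm]
  define g where "g = (\<lambda>j. a (real j / real n))"
  have s: "0 < s" "s\<^sup>2 = real n" using n by (auto simp: s_def)
  have vn: "0 \<le> v * real n" using a(1) by simp
  have g0: "g j = 0" if "N < j" for j
  proof -
    \<comment> \<open>An integer above n + floor(v n) also exceeds n + v n, so the sample point lies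
      beyond 1 + v.\<close>
    have "real n + (v * real n) < real j"
      using that vn unfolding N_def by linarith
    then show ?thesis
      unfolding g_def using n by (intro a(3)) (simp add: field_simps)
  qed
  have sup: "norm (half_line_deriv l a t) \<le> M" if "0 \<le> t" "l \<le> k" for l t
  proof -
    have "norm (half_line_deriv l a t) \<le> half_line_sup_norm (half_line_deriv l a)"
      using a that by (intro norm_le_half_line_sup_norm[where b = "1 + v"]) auto
    also have "\<dots> \<le> M"
      unfolding M_def using that by (intro Max_ge) auto
    finally show ?thesis .
  qed
  have M: "0 \<le> M"
    using sup[of 0 0] norm_ge_zero[of "half_line_deriv 0 a 0"] by linarith
  have gb: "norm ((diff1 ^^ l) g m) \<le> M / s ^ (2 * l)" if "l \<le> k" for l m
  proof -
    have "norm ((diff1 ^^ l) (\<lambda>m. half_line_deriv 0 a (real m * (1 / real n))) m) \<le> M * (1 / real n) ^ l"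
      using n sup that
      by (intro norm_funpow_diff1_le half_line_deriv_has_vector_derivative a(2)) auto
    also have "(\<lambda>m. half_line_deriv 0 a (real m * (1 / real n))) = g"
      by (simp add: g_def half_line_deriv_def)
    also have "M * (1 / real n) ^ l = M / s ^ (2 * l)"
      by (simp add: power_mult s power_one_over)
    finally show ?thesis .
  qed
  \<comment> \<open>N \<le> (1 + v) n, and P \<le> P n because n \<ge> 1; hence the form of
    \<open>E\<close>.\<close>
  have "real N \<le> real n + v * real n"
    unfolding N_def using vn by linarith
  moreover have "real P * 1 \<le> real P * real n"
    using n by (intro mult_left_mono) auto
  ultimately have EP: "4 * real (N + P) \<le> E * s\<^sup>2"
    unfolding E_def s(2) by (simp add: algebra_simps)
  have E: "1 \<le> E" unfolding E_def using a(1) by simp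
  have EQ: "4 * real (N + k) \<le> E * s\<^sup>2" using EP by (simp add: P_def)
  obtain ws where ws: "length ws = p" "set ws \<subseteq> unit_letters"
    "partial_deriv_multi \<alpha> (\<lambda>z. pairing N g (hermite_family z) (hermite_family y))
      = (\<lambda>z. pairing N g (word ws (hermite_family z)) (hermite_family y))"
    unfolding p_def by (rule partial_deriv_multi_pairing)
  define V where "V = norm (pairing N g (word ws (hermite_family x)) (hermite_family y))"
  have "(\<lambda>z. Lambda_kernel a n z y) = (\<lambda>z. pairing N g (hermite_family z) (hermite_family y))"
    unfolding g_def using g0[unfolded g_def] by (intro ext Lambda_kernel_eq_pairing)
  with ws(3) have V: "norm (partial_deriv_multi \<alpha> (\<lambda>z. Lambda_kernel a n z y) x) = V"
    by (simp add: V_def)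
  define B where "B = M * (E ^ P * sqrt (K_kernel (N + P) x x)) * (E ^ k * sqrt (K_kernel (N + k) y y)) * s ^ p"
  \<comment> \<open>The x-side starts with the p derivative letters and the y-side with the empty
    word, which explains the degrees N + p + k and N + k.\<close>
  have bound: "\<bar>x $ i - y $ i\<bar> ^ m * V \<le> R ^ m * B / s ^ m" if "m \<le> k" for i m
    using pairing_words_decay[where g = g and N = N and k = k and M = M and s = s and E = E and P = P and Q = k
        and us = ws and ws = "[]" and l = 0 and m = m and i = i and x = x and y = y,
        OF g0 gb M s(1) E EP EQ ws(2)] that ws(1)
    by (simp add: V_def B_def R_def P_def mult.assoc)
  \<comment> \<open>Only the cases m = 0 and m = k of \<open>bound\<close> enter.\<close>
  have "V * (1 + s * norm (x - y)) ^ k \<le> 2 ^ k * (B + real CARD('d) ^ k * (R ^ k * B))"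
  proof (rule one_plus_norm_power_le)
    show "V \<le> B" using bound[of 0] by simp
    show "(s * \<bar>(x - y) $ i\<bar>) ^ k * V \<le> R ^ k * B" for i
      using bound[of k i] s(1) by (simp add: power_mult_distrib field_simps)
  qed (use s in \<open>auto simp: V_def\<close>)
  also have "\<dots> = 2 ^ k * (1 + (real CARD('d) * R) ^ k) * E ^ (P + k) * M
      * (s ^ p * sqrt (K_kernel (N + P) x x) * sqrt (K_kernel (N + k) y y))"
    by (simp add: B_def power_add power_mult_distrib algebra_simps)
  finally show ?thesis unfolding V .
qed

theorem theorem2p2:
  "\<exists>c :: nat \<Rightarrow> nat \<Rightarrow> real \<Rightarrow> real \<Rightarrow> real.
     \<forall>(a :: real \<Rightarrow> complex) (u :: real) (v :: real)
       (\<alpha> :: 'd::{finite,linorder} \<Rightarrow> nat) (k :: nat).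
     admissible u v a \<longrightarrow> k \<ge> 1 \<longrightarrow>
     (\<forall>(n :: nat) (x :: (real, 'd) vec) (y :: (real, 'd) vec). n \<ge> 1 \<longrightarrow>
        norm (partial_deriv_multi \<alpha> (\<lambda>z. Lambda_kernel a n z y) x)
        \<le> (c k (mi_size \<alpha>) u v * (MAX l\<in>{0..k}. half_line_sup_norm (half_line_deriv l a)))
          * (real n powr (real (mi_size \<alpha>) / 2)
             * sqrt (K_kernel (n + nat \<lfloor>v * real n\<rfloor> + mi_size \<alpha> + k) x x)
             * sqrt (K_kernel (n + nat \<lfloor>v * real n\<rfloor> + k) y y))
          / (1 + sqrt (real n) * norm (x - y)) ^ k)"
proof -
  \<comment> \<open>The constant of \<open>partial_deriv_Lambda_kernel_bound\<close>, fixed before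
    the cut-off function; the exponent p + k + k is P + k.\<close>
  define c where "c = (\<lambda>k p (u::real) v. 2 ^ k * (1 + (real CARD('d) * (2 + 2 * real (p + k) + 2 * real k)) ^ k)
      * (4 * (1 + v + real (p + k))) ^ (p + k + k))"
  show ?thesis
  proof (intro exI[of _ c] allI impI)
    fix a :: "real \<Rightarrow> complex" and u v :: real and \<alpha> :: "'d \<Rightarrow> nat" and k n :: nat
      and x y :: "(real, 'd) vec"
    assume adm: "admissible u v a" and n: "n \<ge> 1"
    have "0 < 1 + sqrt (real n) * norm (x - y)"
      by (simp add: add_pos_nonneg)
    moreover have "real n powr (real (mi_size \<alpha>) / 2) = sqrt (real n) ^ mi_size \<alpha>"
      using n by (simp add: powr_half_sqrt[symmetric] powr_powr flip: powr_realpow)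
    ultimately show "norm (partial_deriv_multi \<alpha> (\<lambda>z. Lambda_kernel a n z y) x)
        \<le> (c k (mi_size \<alpha>) u v * (MAX l\<in>{0..k}. half_line_sup_norm (half_line_deriv l a)))
          * (real n powr (real (mi_size \<alpha>) / 2)
             * sqrt (K_kernel (n + nat \<lfloor>v * real n\<rfloor> + mi_size \<alpha> + k) x x)
             * sqrt (K_kernel (n + nat \<lfloor>v * real n\<rfloor> + k) y y))
          / (1 + sqrt (real n) * norm (x - y)) ^ k"
      using partial_deriv_Lambda_kernel_bound[OF adm n, of \<alpha> y x k]
      unfolding c_def by (simp only: le_divide_eq zero_less_power if_True add.assoc)
  qed
qed

end
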